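(* Let $B=(000;1212)$ and let $B^m$ denote its $m$-fold concatenation. Let $k\geq1$. For every $k$-state reading $F$, $$F\bigl(B^{k!}\bigr)=F\bigl(B^{2\cdot k!}\bigr),$$ while $$\rho\bigl(B^{k!}\bigr)\neq\rho\bigl(B^{2\cdot k!}\bigr).$$
   Context: $Q_3$ is the $1$-skeleton (graph) of the three-dimensional cube, with vertex set $V=\{0,1\}^3$ and coordinates numbered $0,1,2$; two vertices are adjacent iff they differ in exactly one coordinate. A vertex is written $b_2b_1b_0$ ($b_i$ the $i$-th coordinate) and identified with the integer $4b_2+2b_1+b_0\in\{0,\ldots,7\}$. The basepoint is $o=000$. A walk is $w=(o;a_1a_2\cdots a_n)$ with $n\ge0$, $a_k\in\{0,1,2\}$; its vertex sequence is $v_0=o,v_1,\ldots,v_n$, where $v_k$ is obtained from $v_{k-1}$ by flipping coordinate $a_k$; its $k$-th directed edge is $e_k=(v_{k-1},v_k)$. It is closed if $v_n=o$. $\mathcal W$ is the monoid of based closed walks under concatenation of step sequences. Reduced loop word: fix the spanning tree of $Q_3$ given by the path $000,001,011,010,110,111,101,100$ (i.e. $0,1,3,2,6,7,5,4$). The five remaining (cotree) edges $(0,2),(0,4),(1,5),(3,7),(4,6)$ are oriented from the smaller to the larger integer and denoted $x_1,\ldots,x_5$ in this order; $F_5$ is the free group on $x_1,\ldots,x_5$. For $w\in\mathcal W$, reading the steps in order, a forward crossing of the $i$-th cotree edge contributes $x_i$, a backward crossing contributes $x_i^{-1}$, and a tree edge contributes nothing; $\rho(w)\in F_5$ is the free reduction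 of the resulting word. A sequential reading consists of a state set $S$, an initial state $s_0\in S$, update maps $T_e:S\to S$ for the directed edges $e$ of $Q_3$, a set $Y$, and an output map $q:S\to Y$. Its value on a walk with directed edge sequence $e_1,\ldots,e_n$ is $q\bigl(T_{e_n}\circ\cdots\circ T_{e_1}(s_0)\bigr)$. A $k$-state reading is a sequential reading whose state set has at most $k$ elements. *)

theory Defs
  imports Main "HOL-Library.FuncSet"
begin

section \<open>The cube graph and its walks\<close>

text \<open>The triple \<open>(b2, b1, b0)\<close> is the vertex written \<open>b2 b1 b0\<close>; coordinate 0 is the last component.\<close>

type_synonym vertex = "bool \<times> bool \<times> bool"

type_synonym edge = "vertex \<times> vertex"

fun coord :: "nat \<Rightarrow> vertex \<Rightarrow> bool" where
  "coord i (b2, b1, b0) = (if i = 0 then b0 else if i = 1 then b1 else b2)"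

fun vcode :: "vertex \<Rightarrow> nat" where
  "vcode (b2, b1, b0) = 4 * of_bool b2 + 2 * of_bool b1 + of_bool b0"

definition base :: vertex where
  "base = (False, False, False)"

definition adjacent :: "vertex \<Rightarrow> vertex \<Rightarrow> bool" where
  "adjacent u v \<longleftrightarrow> card {i \<in> {0, 1, 2}. coord i u \<noteq> coord i v} = 1"

definition directed_edges :: "edge set" where
  "directed_edges = {(u, v). adjacent u v}"

fun flip :: "nat \<Rightarrow> vertex \<Rightarrow> vertex" where
  "flip i (b2, b1, b0) =
     (if i = 2 then \<not> b2 else b2, if i = 1 then \<not> b1 else b1, if i = 0 then \<not> b0 else b0)"

text \<open>A walk from \<^const>\<open>base\<close> is represented by its sequence of steps.\<close>

definition walks :: "nat list set" where
  "walks = lists {0, 1, 2}"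

fun edges_from :: "vertex \<Rightarrow> nat list \<Rightarrow> edge list" where
  "edges_from v [] = []"
| "edges_from v (a # w) = (v, flip a v) # edges_from (flip a v) w"

definition walk_edges :: "nat list \<Rightarrow> edge list" where
  "walk_edges w = edges_from base w"

definition closed_walks :: "nat list set" where
  "closed_walks = {w \<in> walks. fold flip w base = base}"

definition walk_power :: "nat list \<Rightarrow> nat \<Rightarrow> nat list" where
  "walk_power w m = concat (replicate m w)"

definition B :: "nat list" where
  "B = [1, 2, 1, 2]"

lemma adjacent_triple:
  "adjacent (a, b, c) (a', b', c') \<longleftrightarrow>
     of_bool (a \<noteq> a') + of_bool (b \<noteq> b') + of_bool (c \<noteq> c') = (1::nat)"
proof -
  have "{i \<in> {0, 1, 2}. coord i (a, b, c) \<noteq> coord i (a', b', c')} =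
      (if c = c' then {} else {0}) \<union> (if b = b' then {} else {1}) \<union> (if a = a' then {} else {2})"
    by (rule set_eqI) auto
  then have "card {i \<in> {0, 1, 2}. coord i (a, b, c) \<noteq> coord i (a', b', c')} =
      of_bool (a \<noteq> a') + of_bool (b \<noteq> b') + of_bool (c \<noteq> c')"
    by simp
  then show ?thesis
    by (simp only: adjacent_def)
qed

lemma adjacent_flip: "i \<in> {0, 1, 2} \<Longrightarrow> adjacent v (flip i v)"
  by (cases v) (auto simp: adjacent_triple)

lemma edges_from_directed:
  "set w \<subseteq> {0, 1, 2} \<Longrightarrow> set (edges_from v w) \<subseteq> directed_edges"
proof (induction w arbitrary: v)
  case (Cons a w)
  then have "adjacent v (flip a v)"
    by (intro adjacent_flip) simp
  then show ?case
    using Cons by (auto simp: directed_edges_def)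
qed simp

lemma walk_power_B_closed: "walk_power B m \<in> closed_walks"
proof (induction m)
  case 0
  then show ?case by (simp add: walk_power_def closed_walks_def walks_def)
next
  case (Suc m)
  have "fold flip B base = base" by (simp add: B_def base_def)
  with Suc show ?case
    by (auto simp: walk_power_def closed_walks_def walks_def B_def)
qed


section \<open>Free reduction and the reduced loop word\<close>

text \<open>
  A letter \<open>(i, True)\<close> is the generator \<open>x\<^sub>i\<close>, and \<open>(i, False)\<close> is its inverse. Elements of the free
  group are represented by reduced words. The lemma \<open>free_reduce_iff\<close> states that \<open>free_reduce w\<close>
  is the only reduced word obtainable from \<open>w\<close> by deleting adjacent inverse pairs.
\<close>

type_synonym letter = "nat \<times> bool"

fun inv_letter :: "letter \<Rightarrow> letter" where
  "inv_letter (i, s) = (i, \<not> s)"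

fun reduced :: "letter list \<Rightarrow> bool" where
  "reduced (x # y # w) \<longleftrightarrow> y \<noteq> inv_letter x \<and> reduced (y # w)"
| "reduced _ \<longleftrightarrow> True"

fun cancel_cons :: "letter \<Rightarrow> letter list \<Rightarrow> letter list" where
  "cancel_cons x [] = [x]"
| "cancel_cons x (y # w) = (if y = inv_letter x then w else x # y # w)"

definition free_reduce :: "letter list \<Rightarrow> letter list" where
  "free_reduce w = foldr cancel_cons w []"

inductive cancel_step :: "letter list \<Rightarrow> letter list \<Rightarrow> bool" where
  "cancel_step (u @ [x, inv_letter x] @ v) (u @ v)"

lemma inv_inv_letter [simp]: "inv_letter (inv_letter x) = x"
  by (cases x) simp

lemma reduced_tl: "reduced (x # w) \<Longrightarrow> reduced w"
  by (cases w) auto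

lemma reduced_cancel_cons: "reduced w \<Longrightarrow> reduced (cancel_cons x w)"
  by (cases w) (auto dest: reduced_tl)

lemma reduced_free_reduce: "reduced (free_reduce w)"
  unfolding free_reduce_def by (induction w) (auto intro: reduced_cancel_cons)

lemma free_reduce_reduced: "reduced w \<Longrightarrow> free_reduce w = w"
  unfolding free_reduce_def by (induction w rule: reduced.induct) auto

lemma cancel_cons_inv: "reduced w \<Longrightarrow> cancel_cons x (cancel_cons (inv_letter x) w) = w"
proof (cases w)
  case (Cons y v)
  assume "reduced w"
  with Cons show ?thesis by (cases v) auto
qed simp

lemma free_reduce_cancel_step: "cancel_step w w' \<Longrightarrow> free_reduce w = free_reduce w'"
proof (induction rule: cancel_step.induct)
  case (1 u x v)
  have "cancel_cons x (cancel_cons (inv_letter x) (free_reduce v)) = free_reduce v"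
    by (rule cancel_cons_inv[OF reduced_free_reduce])
  then show ?case by (simp add: free_reduce_def)
qed

lemma cancel_step_Cons: "cancel_step w w' \<Longrightarrow> cancel_step (x # w) (x # w')"
  by (metis append_Cons cancel_step.simps)

lemma cancel_steps_Cons: "cancel_step\<^sup>*\<^sup>* w w' \<Longrightarrow> cancel_step\<^sup>*\<^sup>* (x # w) (x # w')"
  by (induction rule: rtranclp_induct) (auto intro: rtranclp.rtrancl_into_rtrancl cancel_step_Cons)

lemma cancel_steps_cancel_cons: "cancel_step\<^sup>*\<^sup>* (x # w) (cancel_cons x w)"
proof (cases w)
  case (Cons y v)
  have "cancel_step (x # inv_letter x # v) v"
    using cancel_step.intros[of "[]" x v] by simp
  with Cons show ?thesis by auto
qed simp

lemma cancel_steps_free_reduce: "cancel_step\<^sup>*\<^sup>* w (free_reduce w)"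
proof (induction w)
  case (Cons x w)
  have "cancel_step\<^sup>*\<^sup>* (x # w) (x # free_reduce w)"
    using Cons by (rule cancel_steps_Cons)
  also have "cancel_step\<^sup>*\<^sup>* (x # free_reduce w) (free_reduce (x # w))"
    using cancel_steps_cancel_cons by (simp add: free_reduce_def)
  finally show ?case .
qed (simp add: free_reduce_def)

lemma free_reduce_iff: "free_reduce w = r \<longleftrightarrow> cancel_step\<^sup>*\<^sup>* w r \<and> reduced r"
proof
  assume "cancel_step\<^sup>*\<^sup>* w r \<and> reduced r"
  moreover have "cancel_step\<^sup>*\<^sup>* w r \<Longrightarrow> free_reduce w = free_reduce r"
    by (induction rule: rtranclp_induct) (auto dest: free_reduce_cancel_step)
  ultimately show "free_reduce w = r" by (simp add: free_reduce_reduced)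
qed (use cancel_steps_free_reduce reduced_free_reduce in auto)

text \<open>The spanning tree is a Hamiltonian path; it and the cotree edges are given by vertex codes.\<close>

definition tree_path :: "nat list" where
  "tree_path = [0, 1, 3, 2, 6, 7, 5, 4]"

definition cotree_edges :: "(nat \<times> nat) list" where
  "cotree_edges = [(0, 2), (0, 4), (1, 5), (3, 7), (4, 6)]"

lemma cotree_edges_iff:
  "(vcode u, vcode v) \<in> set cotree_edges \<longleftrightarrow>
     adjacent u v \<and> vcode u < vcode v \<and>
     (vcode u, vcode v) \<notin> set (zip tree_path (tl tree_path)) \<and>
     (vcode v, vcode u) \<notin> set (zip tree_path (tl tree_path))"
proof -
  obtain a b c a' b' c' where uv: "u = (a, b, c)" "v = (a', b', c')"
    by (metis surj_pair)
  show ?thesis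
    unfolding uv adjacent_triple cotree_edges_def tree_path_def
    by (cases a; cases b; cases c; cases a'; cases b'; cases c') simp_all
qed

definition edge_word :: "edge \<Rightarrow> letter list" where
  "edge_word = (\<lambda>(u, v). concat (map (\<lambda>i.
     if (vcode u, vcode v) = cotree_edges ! (i - 1) then [(i, True)]
     else if (vcode v, vcode u) = cotree_edges ! (i - 1) then [(i, False)]
     else []) [1, 2, 3, 4, 5]))"

definition rho :: "nat list \<Rightarrow> letter list" where
  "rho w = free_reduce (concat (map edge_word (walk_edges w)))"


section \<open>Sequential readings\<close>

record ('s, 'y) reading =
  states :: "'s set"
  init :: 's
  upd :: "edge \<Rightarrow> 's \<Rightarrow> 's"
  outs :: "'y set"
  outmap :: "'s \<Rightarrow> 'y"

definition sequential_reading :: "('s, 'y) reading \<Rightarrow> bool" where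
  "sequential_reading F \<longleftrightarrow>
     init F \<in> states F \<and>
     (\<forall>e \<in> directed_edges. upd F e \<in> states F \<rightarrow> states F) \<and>
     outmap F \<in> states F \<rightarrow> outs F"

definition state_reading :: "nat \<Rightarrow> ('s, 'y) reading \<Rightarrow> bool" where
  "state_reading k F \<longleftrightarrow> sequential_reading F \<and> finite (states F) \<and> card (states F) \<le> k"

definition reading_value :: "('s, 'y) reading \<Rightarrow> nat list \<Rightarrow> 'y" where
  "reading_value F w = outmap F (fold (upd F) (walk_edges w) (init F))"

end

theory Submission
  imports Defs
begin

text \<open>
  Traversing a closed walk \<open>m\<close> times applies the same composite update \<open>m\<close> times. On at most \<open>k\<close>
  states, the orbit of the initial state becomes periodic after at most \<open>k \<le> k!\<close> steps, with a
  period that is at most \<open>k\<close> and hence divides \<open>k!\<close>; so \<open>k!\<close> and \<open>2 \<cdot> k!\<close> iterations lead to the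
  same state (\<open>funpow_fact_eq\<close>). The free group, by contrast, counts the traversals: \<^const>\<open>B\<close> runs
  through the vertices \<open>0, 2, 6, 4, 0\<close> and contributes \<open>x\<^sub>1 x\<^sub>5\<inverse> x\<^sub>2\<inverse>\<close>, which is cyclically reduced.
  No cancellation occurs in its powers, and the reduced loop word of \<open>B\<^sup>m\<close> has length \<open>3 m\<close>
  (\<open>length_rho_walk_power_B\<close>).
\<close>

lemma edges_from_append:
  "edges_from v (u @ w) = edges_from v u @ edges_from (fold flip u v) w"
  by (induction u arbitrary: v) auto

lemma walk_edges_walk_power:
  assumes "fold flip w base = base"
  shows "walk_edges (walk_power w m) = concat (replicate m (walk_edges w))"
  using assms by (induction m) (simp_all add: walk_edges_def walk_power_def edges_from_append)

lemma fold_concat_replicate: "fold f (concat (replicate m xs)) = fold f xs ^^ m"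
  by (induction m) (simp_all del: funpow.simps add: funpow_Suc_right funpow_0[abs_def] fun_eq_iff)

lemma fold_in_closed:
  assumes "\<And>e. e \<in> set es \<Longrightarrow> f e \<in> S \<rightarrow> S" "s \<in> S"
  shows "fold f es s \<in> S"
  using assms by (induction es arbitrary: s) auto

text \<open>
  Two of the first \<open>k + 1\<close> iterates coincide, say those with exponents \<open>i < j \<le> k\<close>. From exponent
  \<open>i\<close> on, the orbit then has period \<open>j - i\<close>; here \<open>i \<le> k!\<close> and \<open>j - i\<close> divides \<open>k!\<close>.
\<close>

lemma funpow_fact_eq:
  fixes f :: "'a \<Rightarrow> 'a"
  assumes S: "finite S" "card S \<le> k" and f: "f \<in> S \<rightarrow> S" and x: "x \<in> S"
  shows "(f ^^ (2 * fact k)) x = (f ^^ fact k) x"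
proof -
  have orbit: "(f ^^ i) x \<in> S" for i
    using f x by (induction i) auto
  have "\<not> inj_on (\<lambda>i. (f ^^ i) x) {..k}"
  proof
    assume "inj_on (\<lambda>i. (f ^^ i) x) {..k}"
    then have "card {..k} \<le> card S"
      using S(1) orbit by (intro card_inj_on_le) auto
    with S(2) show False by simp
  qed
  then obtain i j where ij: "i < j" "j \<le> k" "(f ^^ i) x = (f ^^ j) x"
    by (auto simp: inj_on_def) (metis linorder_neqE_nat)
  define d where "d = j - i"
  have step: "(f ^^ (n + d)) x = (f ^^ n) x" if "i \<le> n" for n
  proof -
    have shift: "(f ^^ (n - i)) ((f ^^ l) x) = (f ^^ (n - i + l)) x" for l
      by (simp add: funpow_add)
    have "n + d = n - i + j" "n = n - i + i"
      using that ij(1) by (simp_all add: d_def)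
    then show ?thesis
      by (metis shift ij(3))
  qed
  have period: "(f ^^ (n + c * d)) x = (f ^^ n) x" if "i \<le> n" for n c
  proof (induction c)
    case (Suc c)
    have "(f ^^ (n + c * d + d)) x = (f ^^ (n + c * d)) x"
      using that by (intro step) simp
    with Suc show ?case by (simp add: ac_simps)
  qed simp
  have "d dvd fact k"
    using ij by (intro dvd_fact) (auto simp: d_def)
  then obtain c where c: "fact k = c * d"
    by (metis dvd_def mult.commute)
  have "i \<le> fact k"
    using ij fact_ge_self[of k] by linarith
  then have "(f ^^ (fact k + c * d)) x = (f ^^ fact k) x"
    by (rule period)
  then show ?thesis
    by (simp only: c[symmetric] mult_2)
qed

lemma reading_value_walk_power_fact:
  assumes F: "state_reading k F" and w: "w \<in> closed_walks"
  shows "reading_value F (walk_power w (fact k)) = reading_value F (walk_power w (2 * fact k))"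
proof -
  define T where "T = fold (upd F) (walk_edges w)"
  have closed: "fold flip w base = base" and steps: "set w \<subseteq> {0, 1, 2}"
    using w by (auto simp: closed_walks_def walks_def)
  have "upd F e \<in> states F \<rightarrow> states F" if "e \<in> set (walk_edges w)" for e
  proof -
    have "e \<in> directed_edges"
      using that edges_from_directed[OF steps] unfolding walk_edges_def by blast
    with F show ?thesis
      by (simp add: state_reading_def sequential_reading_def)
  qed
  then have T: "T \<in> states F \<rightarrow> states F"
    unfolding T_def by (blast intro: fold_in_closed)
  have reading: "reading_value F (walk_power w m) = outmap F ((T ^^ m) (init F))" for m
    by (simp add: reading_value_def T_def walk_edges_walk_power[OF closed] fold_concat_replicate)
  have "(T ^^ (2 * fact k)) (init F) = (T ^^ fact k) (init F)"
    using F T by (intro funpow_fact_eq) (auto simp: state_reading_def sequential_reading_def)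
  then show ?thesis
    by (simp only: reading)
qed

lemma concat_map_concat_replicate:
  "concat (map f (concat (replicate m xs))) = concat (replicate m (concat (map f xs)))"
  by (induction m) simp_all

lemma edge_word_walk_edges_B:
  "concat (map edge_word (walk_edges B)) = [(1, True), (5, False), (2, False)]"
  by (simp add: walk_edges_def B_def base_def edge_word_def cotree_edges_def)

lemma reduced_power_B_word:
  "reduced (concat (replicate m [(1, True), (5, False), (2, False)]))"
proof (induction m)
  case (Suc m)
  then show ?case by (cases m) simp_all
qed simp

lemma length_rho_walk_power_B: "length (rho (walk_power B m)) = 3 * m"
proof -
  have "fold flip B base = base"
    by (simp add: B_def base_def)
  then have "rho (walk_power B m) = concat (replicate m [(1, True), (5, False), (2, False)])"
    by (simp only: rho_def walk_edges_walk_power concat_map_concat_replicate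
        edge_word_walk_edges_B free_reduce_reduced[OF reduced_power_B_word])
  then show ?thesis
    by (simp add: length_concat sum_list_replicate)
qed

theorem theorem5p2:
  fixes k :: nat
  assumes "k \<ge> 1"
  shows "(\<forall>F :: ('s, 'y) reading. state_reading k F \<longrightarrow>
            reading_value F (walk_power B (fact k)) = reading_value F (walk_power B (2 * fact k))) \<and>
         rho (walk_power B (fact k)) \<noteq> rho (walk_power B (2 * fact k))"
proof (intro conjI allI impI)
  have "B \<in> closed_walks"
    using walk_power_B_closed[of 1] by (simp add: walk_power_def)
  then show "reading_value F (walk_power B (fact k)) = reading_value F (walk_power B (2 * fact k))"
    if "state_reading k F" for F :: "('s, 'y) reading"
    using that by (intro reading_value_walk_power_fact)
  have "length (rho (walk_power B (fact k))) \<noteq> length (rho (walk_power B (2 * fact k)))"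
    by (simp add: length_rho_walk_power_B)
  then show "rho (walk_power B (fact k)) \<noteq> rho (walk_power B (2 * fact k))"
    by metis
qed

end
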